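(* The set $D$ of $82$ squares listed in the context is a dominating set of $Q_{163}$.
   Context: The queen's graph $Q_{163}$ is the graph whose vertices are the squares of the $163\times163$ chessboard, two distinct vertices being adjacent when their squares share a row, a column, or a diagonal (in either of the two diagonal directions). The squares are identified with $B=\{(x,y)\in\mathbb{Z}^2:-81\leq x,y\leq 81\}$, where $x$ is the column and $y$ the row, so that distinct $(x,y)$ and $(a,b)$ are adjacent exactly when at least one of $x=a$, $y=b$, $y-x=b-a$, $x+y=a+b$ holds. A dominating set is a set of squares such that every square of the board belongs to the set or is adjacent to a square of it. The set $D\subseteq B$ consists of the following $82$ squares: (-81,-41), (-79,-19), (-77,31), (-75,25), (-73,-9), (-71,49), (-69,55), (-67,-39), (-65,-29), (-63,-51), (-61,51), (-59,-67), (-57,15), (-55,-23), (-53,27), (-51,77), (-49,-69), (-47,57), (-45,-25), (-43,-43), (-41,75), (-39,-71), (-37,39), (-35,-45), (-33,-57), (-31,61), (-29,-33), (-27,69), (-25,-77), (-23,65), (-21,-7), (-19,11), (-17,67), (-15,53), (-13,-11), (-11,-5), (-9,13), (-7,19), (-5,-61), (-3,-17), (-1,9), (1,-1), (3,21), (5,-63), (7,-81), (9,-21), (11,-15), (13,7), (15,59), (17,73), (19,-3), (21,-75), (23,5), (25,-59), (27,79), (29,37), (31,-49), (33,81), (35,23), (37,41), (39,63), (41,-79), (43,-73), (45,-31), (47,47), (49,-55), (51,35), (53,-47), (55,71), (57,-35), (59,-13), (61,1), (63,-65), (65,17), (67,3), (69,29), (71,-53), (73,45), (75,-37), (77,33),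 (79,43), (81,-27). *)

theory Defs
  imports "Graph_Theory.Pair_Digraph"
begin

text \<open>
  A simple graph is a loop-free symmetric digraph whose arcs are ordered pairs of vertices
  (locale \<^locale>\<open>pair_graph\<close>); for such a graph \<open>u \<rightarrow>\<^bsub>G\<^esub> v\<close> means that \<open>u\<close> and \<open>v\<close> are adjacent.
\<close>

definition dominating_set :: "('a, 'b) pre_digraph \<Rightarrow> 'a set \<Rightarrow> bool" where
  "dominating_set G S \<longleftrightarrow>
     S \<subseteq> verts G \<and> (\<forall>v\<in>verts G. v \<in> S \<or> (\<exists>u\<in>S. v \<rightarrow>\<^bsub>G\<^esub> u))"

text \<open>A square is a pair (column, row).\<close>

definition queen_adjacent :: "int \<times> int \<Rightarrow> int \<times> int \<Rightarrow> bool" where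
  "queen_adjacent = (\<lambda>(x, y) (a, b). (x, y) \<noteq> (a, b) \<and>
     (x = a \<or> y = b \<or> y - x = b - a \<or> x + y = a + b))"

definition queens_graph :: "(int \<times> int) set \<Rightarrow> (int \<times> int) pair_pre_digraph" where
  "queens_graph B = \<lparr>pverts = B, parcs = {(u, v). u \<in> B \<and> v \<in> B \<and> queen_adjacent u v}\<rparr>"

definition board :: "(int \<times> int) set" where
  "board = {-81..81} \<times> {-81..81}"

abbreviation Q163 :: "(int \<times> int) pair_pre_digraph" where
  "Q163 \<equiv> queens_graph board"

definition D :: "(int \<times> int) set" where
  "D = {
    (-81,-41), (-79,-19), (-77,31), (-75,25), (-73,-9), (-71,49),
    (-69,55), (-67,-39), (-65,-29), (-63,-51), (-61,51), (-59,-67),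
    (-57,15), (-55,-23), (-53,27), (-51,77), (-49,-69), (-47,57),
    (-45,-25), (-43,-43), (-41,75), (-39,-71), (-37,39), (-35,-45),
    (-33,-57), (-31,61), (-29,-33), (-27,69), (-25,-77), (-23,65),
    (-21,-7), (-19,11), (-17,67), (-15,53), (-13,-11), (-11,-5),
    (-9,13), (-7,19), (-5,-61), (-3,-17), (-1,9), (1,-1),
    (3,21), (5,-63), (7,-81), (9,-21), (11,-15), (13,7),
    (15,59), (17,73), (19,-3), (21,-75), (23,5), (25,-59),
    (27,79), (29,37), (31,-49), (33,81), (35,23), (37,41),
    (39,63), (41,-79), (43,-73), (45,-31), (47,47), (49,-55),
    (51,35), (53,-47), (55,71), (57,-35), (59,-13), (61,1),
    (63,-65), (65,17), (67,3), (69,29), (71,-53), (73,45),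
    (75,-37), (77,33), (79,43), (81,-27)}"

lemma card_board: "card board = 163 * 163"
  by (simp add: board_def card_cartesian_product)

lemma card_D: "card D = 82"
  by (simp add: D_def)

lemma pair_graph_queens_graph:
  assumes "finite B"
  shows "pair_graph (queens_graph B)"
proof
  show "finite (pverts (queens_graph B))"
    using assms by (simp add: queens_graph_def)
  have "parcs (queens_graph B) \<subseteq> B \<times> B"
    by (auto simp: queens_graph_def)
  then show "finite (parcs (queens_graph B))"
    using assms finite_subset by blast
  show "symmetric (queens_graph B)"
    by (auto simp: symmetric_def queens_graph_def arcs_ends_def arc_to_ends_def
        queen_adjacent_def intro!: symI)
qed (auto simp: queens_graph_def queen_adjacent_def)

lemma queens_graph_adjacent_iff:
  "u \<rightarrow>\<^bsub>queens_graph B\<^esub> v \<longleftrightarrow> u \<in> B \<and> v \<in> B \<and> queen_adjacent u v"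
  by (auto simp: queens_graph_def arcs_ends_def arc_to_ends_def)

end

theory Submission
  imports Defs
begin

text \<open>
  The \<open>82\<close> squares of \<^const>\<open>D\<close> have odd coordinates and occupy each of the \<open>82\<close> odd columns and each
  of the \<open>82\<close> odd rows exactly once. Hence only squares \<open>(x, y)\<close> with \<open>x\<close> and \<open>y\<close> both even have to
  be reached along diagonals. Write \<open>d = y - x\<close> and \<open>s = x + y\<close> for the two diagonals of such a
  square. Both are even, and \<open>s - d = 2 * x\<close> is a multiple of \<open>4\<close>, so that \<open>d\<close> and \<open>s\<close> are in the
  same class modulo \<open>4\<close>. It is therefore enough to occupy, in the main, the difference diagonals of
  class \<open>0\<close> and the sum diagonals of class \<open>2\<close>; \<^const>\<open>D\<close> does so up to \<open>\<bar>d\<bar> = 128\<close> and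
  \<open>\<bar>s\<bar> = 126\<close>. What remains are squares near the corners, with \<open>d\<close> or \<open>s\<close> of large absolute value.
  As \<open>\<bar>d\<bar> + \<bar>s\<bar> = 2 * max \<bar>x\<bar> \<bar>y\<bar> \<le> 160\<close>, the other diagonal of such a square is close to the
  centre, and there \<^const>\<open>D\<close> occupies all even diagonals: those with \<open>\<bar>d\<bar> \<le> 32\<close> and those with
  \<open>\<bar>s\<bar> \<le> 30\<close>.

  Lemma \<open>dominating_if_lines_occupied\<close> is this argument for an arbitrary set of queens; the
  lemmas after it verify that \<^const>\<open>D\<close> occupies the lines in question.
\<close>

lemma dominating_set_queens_graphI:
  assumes "S \<subseteq> B"
    and "\<And>x y. (x, y) \<in> B \<Longrightarrow>
      x \<in> fst ` S \<or> y \<in> snd ` S \<or> y - x \<in> (\<lambda>(a, b). b - a) ` S \<or> x + y \<in> (\<lambda>(a, b). a + b) ` S"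
  shows "dominating_set (queens_graph B) S"
  unfolding dominating_set_def queens_graph_adjacent_iff
proof (intro conjI ballI)
  show "S \<subseteq> verts (queens_graph B)"
    using assms(1) by (simp add: queens_graph_def)
next
  fix v assume "v \<in> verts (queens_graph B)"
  then obtain x y where v: "v = (x, y)" "(x, y) \<in> B"
    by (cases v) (simp add: queens_graph_def)
  then obtain a b where "(a, b) \<in> S" "x = a \<or> y = b \<or> y - x = b - a \<or> x + y = a + b"
    using assms(2) by fastforce
  then show "v \<in> S \<or> (\<exists>u\<in>S. v \<in> B \<and> u \<in> B \<and> queen_adjacent v u)"
    using v assms(1) by (cases "(a, b) = (x, y)") (auto simp: queen_adjacent_def)
qed

text \<open>
  The numbers \<open>p\<close> and \<open>q\<close> say how far from the centre the sparse families of diagonals reach. An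
  even square beyond \<open>p\<close> or \<open>q\<close> in one direction satisfies \<open>\<bar>y - x\<bar> + \<bar>x + y\<bar> \<le> 2 * (n - 1)\<close>,
  because \<open>n\<close> is odd; this determines how wide the dense central bands have to be in the other
  direction.
\<close>

lemma dominating_if_lines_occupied:
  fixes n p q :: int
  assumes board: "S \<subseteq> {-n..n} \<times> {-n..n}" and "odd n"
    and columns: "\<And>x. odd x \<Longrightarrow> \<bar>x\<bar> \<le> n \<Longrightarrow> x \<in> fst ` S"
    and rows: "\<And>y. odd y \<Longrightarrow> \<bar>y\<bar> \<le> n \<Longrightarrow> y \<in> snd ` S"
    and differences: "\<And>d. d mod 4 = 0 \<Longrightarrow> \<bar>d\<bar> \<le> p \<Longrightarrow> d \<in> (\<lambda>(a, b). b - a) ` S"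
    and sums: "\<And>s. s mod 4 = 2 \<Longrightarrow> \<bar>s\<bar> \<le> q \<Longrightarrow> s \<in> (\<lambda>(a, b). a + b) ` S"
    and central_differences:
      "\<And>d. even d \<Longrightarrow> \<bar>d\<bar> < 2 * (n - 1) - q \<Longrightarrow> d \<in> (\<lambda>(a, b). b - a) ` S"
    and central_sums:
      "\<And>s. even s \<Longrightarrow> \<bar>s\<bar> < 2 * (n - 1) - p \<Longrightarrow> s \<in> (\<lambda>(a, b). a + b) ` S"
  shows "dominating_set (queens_graph ({-n..n} \<times> {-n..n})) S"
proof (rule dominating_set_queens_graphI[OF board])
  fix x y :: int
  assume xy: "(x, y) \<in> {-n..n} \<times> {-n..n}"
  show "x \<in> fst ` S \<or> y \<in> snd ` S \<or>
    y - x \<in> (\<lambda>(a, b). b - a) ` S \<or> x + y \<in> (\<lambda>(a, b). a + b) ` S"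
  proof (cases "odd x \<or> odd y")
    case True
    then show ?thesis
      using xy columns[of x] rows[of y] by (auto simp: abs_le_iff)
  next
    case False
    then have even: "even (y - x)" "even (x + y)"
      by auto
    have "\<bar>x\<bar> \<noteq> n" "\<bar>y\<bar> \<noteq> n"
      using False \<open>odd n\<close> by auto
    then have bound: "\<bar>y - x\<bar> + \<bar>x + y\<bar> \<le> 2 * (n - 1)"
      using xy by auto
    have "(y - x) mod 4 = 0 \<or> (x + y) mod 4 = 2"
      using False by presburger
    then show ?thesis
    proof
      assume "(y - x) mod 4 = 0"
      then show ?thesis
        using differences[of "y - x"] central_sums[of "x + y"] even bound by linarith
    next
      assume "(x + y) mod 4 = 2"
      then show ?thesis
        using sums[of "x + y"] central_differences[of "y - x"] even bound by linarith
    qed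
  qed
qed

text \<open>
  Each class of line numbers is an affine image \<open>c * k + e\<close> of an interval of integers \<open>k\<close>, so that
  its inclusion among the occupied lines becomes a finite evaluation.
\<close>

lemma D_columns:
  assumes "odd x" "\<bar>x\<bar> \<le> 81"
  shows "x \<in> fst ` D"
proof -
  have "\<forall>k\<in>{-41..40}. 2 * k + 1 \<in> fst ` D"
    by code_simp
  moreover obtain k where "x = 2 * k + 1"
    using assms(1) by (rule oddE)
  ultimately show ?thesis
    using assms(2) by (auto simp: abs_le_iff)
qed

lemma D_rows:
  assumes "odd y" "\<bar>y\<bar> \<le> 81"
  shows "y \<in> snd ` D"
proof -
  have "\<forall>k\<in>{-41..40}. 2 * k + 1 \<in> snd ` D"
    by code_simp
  moreover obtain k where "y = 2 * k + 1"
    using assms(1) by (rule oddE)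
  ultimately show ?thesis
    using assms(2) by (auto simp: abs_le_iff)
qed

lemma D_differences:
  assumes "d mod 4 = 0" "\<bar>d\<bar> \<le> 128"
  shows "d \<in> (\<lambda>(a, b). b - a) ` D"
proof -
  have "\<forall>k\<in>{-32..32}. 4 * k \<in> (\<lambda>(a, b). b - a) ` D"
    by code_simp
  moreover have "d = 4 * (d div 4)" "d div 4 \<in> {-32..32}"
    using assms by auto
  ultimately show ?thesis
    by metis
qed

lemma D_sums:
  assumes "s mod 4 = 2" "\<bar>s\<bar> \<le> 126"
  shows "s \<in> (\<lambda>(a, b). a + b) ` D"
proof -
  have "\<forall>k\<in>{-32..31}. 4 * k + 2 \<in> (\<lambda>(a, b). a + b) ` D"
    by code_simp
  moreover have "s = 4 * (s div 4) + 2" "s div 4 \<in> {-32..31}"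
    using assms mult_div_mod_eq[of 4 s] by auto
  ultimately show ?thesis
    by metis
qed

lemma D_central_differences:
  assumes "even d" "\<bar>d\<bar> \<le> 32"
  shows "d \<in> (\<lambda>(a, b). b - a) ` D"
proof -
  have "\<forall>k\<in>{-16..16}. 2 * k \<in> (\<lambda>(a, b). b - a) ` D"
    by code_simp
  moreover obtain k where "d = 2 * k"
    using assms(1) by (rule evenE)
  ultimately show ?thesis
    using assms(2) by (auto simp: abs_le_iff)
qed

lemma D_central_sums:
  assumes "even s" "\<bar>s\<bar> \<le> 30"
  shows "s \<in> (\<lambda>(a, b). a + b) ` D"
proof -
  have "\<forall>k\<in>{-15..15}. 2 * k \<in> (\<lambda>(a, b). a + b) ` D"
    by code_simp
  moreover obtain k where "s = 2 * k"
    using assms(1) by (rule evenE)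
  ultimately show ?thesis
    using assms(2) by (auto simp: abs_le_iff)
qed

theorem proposition1:
  shows "dominating_set Q163 D"
  unfolding board_def
proof (rule dominating_if_lines_occupied[where p = 128 and q = 126])
  show "D \<subseteq> {-81..81} \<times> {-81..81}"
    by (simp add: D_def)
next
  fix d :: int
  assume "even d" "\<bar>d\<bar> < 2 * (81 - 1) - 126"
  \<comment> \<open>The bound is \<open>\<bar>d\<bar> < 34\<close>, and \<open>d\<close> is even.\<close>
  moreover from this have "\<bar>d\<bar> \<le> 32"
    by presburger
  ultimately show "d \<in> (\<lambda>(a, b). b - a) ` D"
    by (intro D_central_differences)
next
  fix s :: int
  assume "even s" "\<bar>s\<bar> < 2 * (81 - 1) - 128"
  moreover from this have "\<bar>s\<bar> \<le> 30"
    by presburger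
  ultimately show "s \<in> (\<lambda>(a, b). a + b) ` D"
    by (intro D_central_sums)
qed (use D_columns D_rows D_differences D_sums in auto)

end
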